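(* Let $\mu>0$ be a (small) positive number, let $\tau\in(0,\,2/\|\mathcal{A}\|_2^2)$, and let $h:\mathbb{S}^n\to\mathbb{S}^n$ be given by $h(X)=X-\tau\,\mathcal{A}^*(\mathcal{A}(X)-b)$. Suppose $W^*\in\mathbb{S}^n_+$ satisfies (1) $\|\mathcal{A}(W^* )-b\|_2<\mu/n$; and (2) $W^*=\mathcal{T}_{\tau\mu}(h(W^* ))$. Let $X^0\in\mathbb{S}^n$ be any initial matrix and, for $k=0,1,2,\dots$, define $$Y^k=X^k-\tau\,\mathcal{A}^*(\mathcal{A}(X^k)-b),\qquad X^{k+1}=\mathcal{T}_{\tau\mu}(Y^k).$$ Then the sequence $\{X^k\}$ converges to $W^*$.
   Context: $\mathbb{S}^n$ is the space of real symmetric $n\times n$ matrices with inner product $\langle X,Y\rangle=\mathrm{Tr}(X^TY)$ and Frobenius norm $\|\cdot\|_F$; $\mathbb{S}^n_+\subset\mathbb{S}^n$ is the set of positive semidefinite matrices. The linear operator $\mathcal{A}$ and vector $b$ come from the Gram matrix problem. Let $f\in\mathbb{R}[x_1,\dots,x_s]$ have degree $2d$ and let $m_d(x)$ be a column vector of $n$ monomials of degree at most $d$. Expanding $f(x)=m_d(x)^T W m_d(x)$ for $W\in\mathbb{S}^n$ and matching the coefficients of the monomials gives $p$ linear equations in the entries of $W$, written $\mathcal{A}(W)=b$, where $b\in\mathbb{R}^p$ is the vector of the corresponding coefficients of $f$ and $\mathcal{A}:\mathbb{S}^n\to\mathbb{R}^p$ has the form $\mathcal{A}(W)=(\mathrm{Tr}(A_i^TW))_{i=1}^p$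 with $A_1,\dots,A_p\in\mathbb{R}^{n\times n}$ (here $A_i$ is the $0/1$ matrix whose $(j,k)$ entry is $1$ exactly when the product of the $j$-th and $k$-th entries of $m_d(x)$ is the $i$-th monomial). $\mathcal{A}^*:\mathbb{R}^p\to\mathbb{S}^n$ is the adjoint of $\mathcal{A}$, and $\|\mathcal{A}\|_2$ is the operator norm of $\mathcal{A}$ with respect to the Frobenius norm on $\mathbb{S}^n$ and the Euclidean norm $\|\cdot\|_2$ on $\mathbb{R}^p$. Thresholding operator: for $\nu\ge 0$ and $W\in\mathbb{S}^n$ with spectral decomposition $W=Q\,\mathrm{diag}(\lambda_1,\dots,\lambda_n)\,Q^T$ ($Q$ real orthogonal), $\mathcal{T}_\nu(W):=Q\,\mathrm{diag}(\max(0,\lambda_1-\nu),\dots,\max(0,\lambda_n-\nu))\,Q^T$. *)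

theory Defs
  imports "HOL-Analysis.Analysis" "HOL-Library.Poly_Mapping"
begin

text \<open>Monomials in the variables indexed by \<open>'s\<close> are exponent maps; a real polynomial maps
  finitely many monomials to nonzero coefficients. Multiplying monomials is adding exponents.\<close>

type_synonym 's monom = "'s \<Rightarrow>\<^sub>0 nat"
type_synonym 's rpoly = "'s monom \<Rightarrow>\<^sub>0 real"

definition monom_degree :: "'s::finite monom \<Rightarrow> nat" where
  "monom_degree a = (\<Sum>x\<in>UNIV. Poly_Mapping.lookup a x)"

text \<open>Convention: the zero polynomial has degree 0.\<close>

definition total_degree :: "'s::finite rpoly \<Rightarrow> nat" where
  "total_degree f = Max (insert 0 (monom_degree ` Poly_Mapping.keys f))"

text \<open>On \<open>real^'n^'n\<close> the library's \<open>inner\<close> and \<open>norm\<close> are the trace inner product and the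
  Frobenius norm (see \<open>inner_matrix_trace\<close> below), so the library's topology is the intended one.\<close>

definition sym_mats :: "(real^'n^'n) set" where
  "sym_mats = {X. transpose X = X}"

definition psd_mats :: "(real^'n^'n) set" where
  "psd_mats = {X \<in> sym_mats. \<forall>v. v \<bullet> (X *v v) \<ge> 0}"

definition diag_mat :: "real^'n \<Rightarrow> real^'n^'n" where
  "diag_mat l = (\<chi> i j. if i = j then l $ i else 0)"

lemma inner_matrix_trace: "(X :: real^'n^'n) \<bullet> Y = trace (transpose X ** Y)"
  unfolding inner_vec_def trace_def matrix_matrix_mult_def transpose_def
  by simp (rule sum.swap)

text \<open>Operator norm and adjoint of a map whose domain is the space of symmetric matrices
  (a map on all matrices is restricted to it).\<close>

definition sym_onorm :: "(real^'n^'n \<Rightarrow> real^'p) \<Rightarrow> real" where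
  "sym_onorm A = (SUP X\<in>sym_mats. norm (A X) / norm X)"

definition sym_adjoint :: "(real^'n^'n \<Rightarrow> real^'p) \<Rightarrow> real^'p \<Rightarrow> real^'n^'n" where
  "sym_adjoint A y = (THE B. B \<in> sym_mats \<and> (\<forall>X\<in>sym_mats. A X \<bullet> y = X \<bullet> B))"

text \<open>The Gram matrix problem for the monomial vector \<open>m\<close>. The family \<open>mon\<close> lists the monomials
  whose coefficients are matched.\<close>

definition gram_poly :: "('s monom)^'n \<Rightarrow> real^'n^'n \<Rightarrow> 's rpoly" where
  "gram_poly m W = (\<Sum>j\<in>UNIV. \<Sum>k\<in>UNIV. Poly_Mapping.single (m $ j) 1 *
     Poly_Mapping.single 0 (W $ j $ k) * Poly_Mapping.single (m $ k) 1)"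

definition gram_mat :: "('s monom)^'n \<Rightarrow> 's monom \<Rightarrow> real^'n^'n" where
  "gram_mat m a = (\<chi> j k. if m $ j + m $ k = a then 1 else 0)"

definition gram_map :: "('s monom)^'n \<Rightarrow> ('p \<Rightarrow> 's monom) \<Rightarrow> real^'n^'n \<Rightarrow> real^'p" where
  "gram_map m mon W = (\<chi> i. trace (transpose (gram_mat m (mon i)) ** W))"

definition gram_rhs :: "('p \<Rightarrow> 's monom) \<Rightarrow> 's rpoly \<Rightarrow> real^'p" where
  "gram_rhs mon f = (\<chi> i. Poly_Mapping.lookup f (mon i))"

text \<open>The family lists, without repetition, at least all monomials occurring on either side of
  \<open>f = m\<^sup>T W m\<close>; a further monomial would only contribute the equation \<open>0 = 0\<close>.\<close>

definition gram_monomials :: "'s rpoly \<Rightarrow> ('s monom)^'n \<Rightarrow> ('p \<Rightarrow> 's monom) \<Rightarrow> bool" where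
  "gram_monomials f m mon \<longleftrightarrow>
     inj mon \<and> {m $ j + m $ k | j k. True} \<union> Poly_Mapping.keys f \<subseteq> range mon"

lemma lookup_gram_poly:
  "Poly_Mapping.lookup (gram_poly m W) a = trace (transpose (gram_mat m a) ** W)"
proof -
  have "Poly_Mapping.lookup (gram_poly m W) a =
      (\<Sum>j\<in>UNIV. \<Sum>k\<in>UNIV. if m $ j + m $ k = a then W $ j $ k else 0)"
    by (simp add: gram_poly_def lookup_sum mult_single lookup_single when_def)
  also have "\<dots> = gram_mat m a \<bullet> W"
    by (auto simp: inner_vec_def gram_mat_def intro!: sum.cong)
  finally show ?thesis
    by (simp add: inner_matrix_trace)
qed

lemma gram_system_iff:
  assumes "gram_monomials f m mon"
  shows "gram_map m mon W = gram_rhs mon f \<longleftrightarrow> f = gram_poly m W"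
proof
  assume eq: "gram_map m mon W = gram_rhs mon f"
  show "f = gram_poly m W"
  proof (rule poly_mapping_eqI)
    fix a
    show "Poly_Mapping.lookup f a = Poly_Mapping.lookup (gram_poly m W) a"
    proof (cases "a \<in> range mon")
      case True
      then show ?thesis
        using eq by (auto simp: gram_map_def gram_rhs_def lookup_gram_poly vec_eq_iff)
    next
      case False
      then have "a \<notin> Poly_Mapping.keys f" and *: "m $ j + m $ k \<noteq> a" for j k
        using assms unfolding gram_monomials_def by blast+
      then have "gram_mat m a = 0"
        by (simp add: gram_mat_def vec_eq_iff)
      with \<open>a \<notin> Poly_Mapping.keys f\<close> show ?thesis
        unfolding lookup_gram_poly inner_matrix_trace[symmetric]
        by (simp add: in_keys_iff)
    qed
  qed
qed (simp add: gram_map_def gram_rhs_def lookup_gram_poly)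

lemma sym_adjoint_gram_map:
  "sym_adjoint (gram_map m mon) y = (\<Sum>i\<in>UNIV. y $ i *\<^sub>R gram_mat m (mon i))" (is "_ = ?B")
  unfolding sym_adjoint_def
proof (rule the_equality)
  have "gram_mat m a \<in> sym_mats" for a
    by (auto simp: sym_mats_def gram_mat_def transpose_def vec_eq_iff add.commute)
  then have "?B \<in> sym_mats"
    by (auto simp: sym_mats_def transpose_def vec_eq_iff)
  moreover have eq: "gram_map m mon X \<bullet> y = X \<bullet> ?B" for X
  proof -
    have "gram_map m mon X \<bullet> y = (\<Sum>i\<in>UNIV. (gram_mat m (mon i) \<bullet> X) * y $ i)"
      by (subst inner_vec_def) (simp add: gram_map_def inner_matrix_trace)
    also have "\<dots> = X \<bullet> ?B"
      by (simp add: inner_sum_right inner_commute[of X] mult.commute)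
    finally show ?thesis .
  qed
  ultimately show "?B \<in> sym_mats \<and> (\<forall>X\<in>sym_mats. gram_map m mon X \<bullet> y = X \<bullet> ?B)"
    by blast
  fix B assume B: "B \<in> sym_mats \<and> (\<forall>X\<in>sym_mats. gram_map m mon X \<bullet> y = X \<bullet> B)"
  have "B - ?B \<in> sym_mats"
    using B \<open>?B \<in> sym_mats\<close> by (auto simp: sym_mats_def transpose_def vec_eq_iff)
  then have "(B - ?B) \<bullet> (B - ?B) = 0"
    using B eq by (simp only: inner_diff_right)
  then show "B = ?B"
    by simp
qed

text \<open>The value does not depend on the chosen spectral decomposition, hence the definite
  description; it is only meaningful for symmetric \<open>W\<close>.\<close>

definition threshold :: "real \<Rightarrow> real^'n^'n \<Rightarrow> real^'n^'n" where
  "threshold \<nu> W = (THE Z. \<exists>Q l. orthogonal_matrix Q \<and>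
      W = Q ** diag_mat l ** transpose Q \<and>
      Z = Q ** diag_mat (\<chi> i. max 0 (l $ i - \<nu>)) ** transpose Q)"

end

theory Submission
  imports Defs
begin

text \<open>
  The hypothesis on the residual is so strong that it forces \<open>W\<^sup>*\<close> to be the zero matrix, and the
  convergence is in fact finite.

  Write \<open>A\<^sup>*\<close> for the adjoint. The spectral theorem shows that for symmetric \<open>Y\<close> the matrix
  \<open>T = threshold \<nu> Y\<close> satisfies \<open>\<parallel>T\<parallel>\<^sup>2 = \<langle>T, Y\<rangle> - \<nu> tr T\<close> and, its eigenvalues being nonnegative,
  \<open>\<parallel>T\<parallel> \<le> tr T\<close>. By Cauchy-Schwarz, thresholding \<open>Z - \<tau> G\<close> at level \<open>\<tau> \<mu>\<close> therefore either gives
  zero or a matrix of norm at most \<open>\<parallel>Z\<parallel> - \<tau> (\<mu> - \<parallel>G\<parallel>)\<close>: if \<open>\<parallel>G\<parallel> < \<mu>\<close>, the norm drops by a fixed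
  positive amount (\<open>norm_threshold_step_le\<close>).

  The matrices of the Gram system have 0/1 entries and disjoint supports, so every entry of
  \<open>A\<^sup>* y\<close> is a coordinate of \<open>y\<close> or zero, whence \<open>\<parallel>A\<^sup>* y\<parallel> \<le> n \<parallel>y\<parallel>\<close>
  (\<open>norm_sym_adjoint_gram_map_le\<close>). For the residual of \<open>W\<^sup>*\<close> this gives a
  gradient \<open>G\<close> of norm less than \<open>\<mu>\<close>, and the fixed point equation says that the step from
  \<open>Z = W\<^sup>*\<close> does not change the norm. This is only possible if \<open>W\<^sup>* = 0\<close>. Then the residual is
  \<open>- b\<close>, so that \<open>\<parallel>A\<^sup>* b\<parallel> < \<mu>\<close>.

  Now let \<open>Z = X\<^sup>k - \<tau> A\<^sup>* (A X\<^sup>k)\<close> and \<open>G = - A\<^sup>* b\<close>. The step size condition makes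
  \<open>\<parallel>Z\<parallel> \<le> \<parallel>X\<^sup>k\<parallel>\<close> (\<open>norm_gradient_step_le\<close>), so each iteration with a nonzero result decreases the norm by at least the
  constant \<open>\<tau> (\<mu> - \<parallel>A\<^sup>* b\<parallel>) > 0\<close>. This can happen only finitely often, and zero is not left again.
\<close>


section \<open>The spectral theorem for real symmetric matrices\<close>

text \<open>A maximizer of the Rayleigh quotient is an eigenvector: moving from the maximizer \<open>x\<close> in the
  direction of \<open>w = f x - \<alpha> x\<close>, which is orthogonal to \<open>x\<close>, would otherwise increase the quotient
  to first order.\<close>

lemma self_adjoint_eigenvector:
  fixes f :: "'a::euclidean_space \<Rightarrow> 'a"
  assumes lin: "linear f" and adj: "\<And>x y. f x \<bullet> y = x \<bullet> f y"
    and S: "subspace S" "f ` S \<subseteq> S" "S \<noteq> {0}"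
  obtains x \<alpha> where "x \<in> S" "norm x = 1" "f x = \<alpha> *\<^sub>R x"
proof -
  obtain y where y: "y \<in> S" "y \<noteq> 0"
    using S(1,3) subspace_0 by blast
  have "compact (S \<inter> sphere 0 1)"
    by (simp add: S(1) closed_Int_compact closed_subspace)
  moreover have "y /\<^sub>R norm y \<in> S \<inter> sphere 0 1"
    using y S(1) by (simp add: subspace_scale)
  moreover have "continuous_on (S \<inter> sphere 0 1) (\<lambda>x. x \<bullet> f x)"
    by (intro continuous_intros linear_continuous_on) (simp add: lin linear_conv_bounded_linear[symmetric])
  ultimately obtain x where x: "x \<in> S" "norm x = 1"
    and max: "\<And>z. z \<in> S \<Longrightarrow> norm z = 1 \<Longrightarrow> z \<bullet> f z \<le> x \<bullet> f x"
    using continuous_attains_sup[of "S \<inter> sphere 0 1" "\<lambda>x. x \<bullet> f x"]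
    by (metis IntE IntI empty_iff mem_sphere_0)
  define \<alpha> where "\<alpha> = x \<bullet> f x"
  have rayleigh: "z \<bullet> f z \<le> \<alpha> * (norm z)\<^sup>2" if "z \<in> S" for z
  proof (cases "z = 0")
    case False
    have "(z /\<^sub>R norm z) \<bullet> f (z /\<^sub>R norm z) \<le> \<alpha>"
      unfolding \<alpha>_def using False that S(1) by (intro max) (simp_all add: subspace_scale)
    then have "(z \<bullet> f z) / (norm z)\<^sup>2 \<le> \<alpha>"
      by (simp add: linear_scale[OF lin] power2_eq_square divide_inverse mult.commute mult.left_commute)
    then show ?thesis
      using False by (simp add: divide_le_eq)
  qed (simp add: linear_0[OF lin])
  define w where "w = f x - \<alpha> *\<^sub>R x"
  define q where "q = w \<bullet> f w - \<alpha> * (norm w)\<^sup>2"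
  have xx: "x \<bullet> x = 1"
    using x(2) by (simp add: dot_square_norm)
  have xw: "x \<bullet> w = 0"
    by (simp add: w_def inner_diff_right \<alpha>_def xx)
  have wS: "w \<in> S"
    using S x(1) by (auto simp: w_def intro!: subspace_diff subspace_scale)
  have fxw: "f x \<bullet> w = (norm w)\<^sup>2"
  proof -
    have "f x = w + \<alpha> *\<^sub>R x"
      by (simp add: w_def)
    then show ?thesis
      by (simp add: inner_left_distrib xw power2_norm_eq_inner)
  qed
  have perturb: "2 * t * (norm w)\<^sup>2 + t\<^sup>2 * q \<le> 0" for t
  proof -
    have "(x + t *\<^sub>R w) \<bullet> f (x + t *\<^sub>R w) \<le> \<alpha> * (norm (x + t *\<^sub>R w))\<^sup>2"
      using x(1) wS S(1) by (intro rayleigh subspace_add subspace_scale)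
    moreover have "(x + t *\<^sub>R w) \<bullet> f (x + t *\<^sub>R w) = \<alpha> + 2 * t * (norm w)\<^sup>2 + t\<^sup>2 * (w \<bullet> f w)"
      using fxw adj[of x w]
      by (simp add: linear_add[OF lin] linear_scale[OF lin] inner_left_distrib inner_right_distrib
          \<alpha>_def inner_commute[of w "f x"] power2_eq_square algebra_simps)
    moreover have "(norm (x + t *\<^sub>R w))\<^sup>2 = 1 + t\<^sup>2 * (norm w)\<^sup>2"
      unfolding power2_norm_eq_inner
      by (simp add: inner_left_distrib inner_right_distrib xx xw inner_commute[of w x] power2_eq_square)
    ultimately show ?thesis
      by (simp add: q_def algebra_simps)
  qed
  have "(norm w)\<^sup>2 = 0"
  proof (rule ccontr)
    assume "(norm w)\<^sup>2 \<noteq> 0"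
    then have pos: "(norm w)\<^sup>2 > 0"
      by simp
    \<comment> \<open>small enough for the linear term to dominate the quadratic one\<close>
    define t where "t = (norm w)\<^sup>2 / (\<bar>q\<bar> + 1)"
    have t: "t > 0" "t * (\<bar>q\<bar> + 1) = (norm w)\<^sup>2"
      using pos by (simp_all add: t_def)
    have "t * (2 * (norm w)\<^sup>2 + t * q) \<le> 0"
      using perturb[of t] by (simp add: power2_eq_square algebra_simps)
    then have "2 * (norm w)\<^sup>2 + t * q \<le> 0"
      using t(1) by (simp add: mult_le_0_iff)
    moreover have "- (t * \<bar>q\<bar>) \<le> t * q"
      using t(1) by (metis abs_le_D2 abs_mult abs_of_pos minus_le_iff order_refl)
    ultimately show False
      using t pos by (simp add: algebra_simps)
  qed
  then have "f x = \<alpha> *\<^sub>R x"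
    by (simp add: w_def)
  with x show ?thesis
    by (rule that)
qed

text \<open>Split off one eigenvector; its orthogonal complement in \<open>S\<close> is again invariant and has
  smaller dimension.\<close>

lemma self_adjoint_eigenbasis:
  fixes f :: "'a::euclidean_space \<Rightarrow> 'a"
  assumes lin: "linear f" and adj: "\<And>x y. f x \<bullet> y = x \<bullet> f y"
    and "subspace S" "f ` S \<subseteq> S"
  shows "\<exists>B. B \<subseteq> S \<and> pairwise orthogonal B \<and> (\<forall>x\<in>B. norm x = 1 \<and> (\<exists>\<alpha>. f x = \<alpha> *\<^sub>R x)) \<and> span B = S"
  using assms(3,4)
proof (induction "dim S" arbitrary: S rule: less_induct)
  case less
  show ?case
  proof (cases "S = {0}")
    case True
    then show ?thesis
      by (intro exI[of _ "{}"]) auto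
  next
    case False
    obtain x \<alpha> where x: "x \<in> S" "norm x = 1" "f x = \<alpha> *\<^sub>R x"
      using self_adjoint_eigenvector[OF lin adj less.prems False] by blast
    define S' where "S' = S \<inter> {y. x \<bullet> y = 0}"
    have S': "subspace S'"
      using less.prems(1) by (simp add: S'_def subspace_inter subspace_hyperplane)
    have inv: "f ` S' \<subseteq> S'"
      using less.prems(2) x(3) by (auto simp: S'_def adj[of x, symmetric])
    have "x \<notin> S'"
      using x(2) by (auto simp: S'_def)
    then have "S' \<subset> S"
      using x(1) unfolding S'_def by blast
    then have "dim S' < dim S"
      using S' less.prems(1) by (metis dim_psubset span_eq_iff)
    then obtain B where B: "B \<subseteq> S'" "pairwise orthogonal B"
      "\<forall>x\<in>B. norm x = 1 \<and> (\<exists>\<alpha>. f x = \<alpha> *\<^sub>R x)" "span B = S'"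
      using less.hyps[OF _ S' inv] by blast
    have "S \<subseteq> span (insert x B)"
    proof
      fix y assume y: "y \<in> S"
      have "y - (x \<bullet> y) *\<^sub>R x \<in> S'"
        using y x less.prems(1)
        by (auto simp: S'_def inner_diff_right dot_square_norm intro!: subspace_diff subspace_scale)
      then show "y \<in> span (insert x B)"
        using B(4) by (auto simp: span_insert)
    qed
    moreover have "span (insert x B) \<subseteq> S"
      using x(1) B(1) less.prems(1) by (intro span_minimal) (auto simp: S'_def)
    moreover have "pairwise orthogonal (insert x B)"
      using B(1,2) by (auto simp: pairwise_insert orthogonal_def S'_def inner_commute)
    ultimately show ?thesis
      using x B(1,3) by (intro exI[of _ "insert x B"]) (auto simp: S'_def)
  qed
qed

lemma matrix_mult_diag_mat: "(Q ** diag_mat l) $ i $ j = Q $ i $ j * l $ j"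
  by (simp add: matrix_matrix_mult_def diag_mat_def if_distrib if_distribR sum.delta cong: if_cong)

lemma diag_mat_matrix_mult: "(diag_mat l ** Q) $ i $ j = l $ i * Q $ i $ j"
  by (simp add: matrix_matrix_mult_def diag_mat_def if_distrib if_distribR sum.delta cong: if_cong)

lemma symmetric_matrix_spectral:
  fixes W :: "real^'n^'n"
  assumes "W \<in> sym_mats"
  obtains Q l where "orthogonal_matrix Q" "W = Q ** diag_mat l ** transpose Q"
proof -
  have "(W *v x) \<bullet> y = x \<bullet> (W *v y)" for x y
    using assms by (metis (mono_tags, lifting) dot_lmul_matrix mem_Collect_eq sym_mats_def
        vector_transpose_matrix)
  then obtain B where B: "pairwise orthogonal B"
    "\<forall>x\<in>B. norm x = 1 \<and> (\<exists>\<alpha>. W *v x = \<alpha> *\<^sub>R x)" "span B = UNIV"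
    using self_adjoint_eigenbasis[of "(*v) W" UNIV] by auto
  have indep: "independent B"
    using B(1,2) by (intro pairwise_orthogonal_independent) auto
  have "card B = CARD('n)"
    using dim_span_eq_card_independent[OF indep] B(3) by simp
  then obtain c where c: "bij_betw c (UNIV :: 'n set) B"
    using indep independent_imp_finite by (metis finite finite_same_card_bij)
  then have cB: "c j \<in> B" for j
    by (auto simp: bij_betw_def)
  with B(2) have "\<exists>\<alpha>. W *v c j = \<alpha> *\<^sub>R c j" for j
    by blast
  then obtain e where e: "\<And>j. W *v c j = e j *\<^sub>R c j"
    by metis
  define Q :: "real^'n^'n" where "Q = (\<chi> i j. c j $ i)"
  define l :: "real^'n" where "l = (\<chi> j. e j)"
  have col: "column j Q = c j" for j
    by (simp add: column_def Q_def vec_eq_iff)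
  have "c i \<noteq> c j" if "i \<noteq> j" for i j
    using c that by (auto simp: bij_betw_def inj_eq)
  then have Q: "orthogonal_matrix Q"
    unfolding orthogonal_matrix_orthonormal_columns col
    using B(1,2) cB by (meson pairwiseD)
  have "W ** Q = Q ** diag_mat l"
  proof -
    have "(W ** Q) $ i $ j = (Q ** diag_mat l) $ i $ j" for i j
    proof -
      have "(W ** Q) $ i $ j = (W *v c j) $ i"
        by (simp add: matrix_matrix_mult_def matrix_vector_mult_def Q_def)
      then show ?thesis
        unfolding matrix_mult_diag_mat by (simp add: e Q_def l_def)
    qed
    then show ?thesis
      by (simp add: vec_eq_iff)
  qed
  then have "W = Q ** diag_mat l ** transpose Q"
    using Q by (metis matrix_mul_assoc matrix_mul_rid orthogonal_matrix_def)
  with Q show ?thesis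
    by (rule that)
qed


section \<open>Eigenvalue thresholding\<close>

text \<open>Two diagonalizations of one matrix are intertwined by \<open>P = Q'\<^sup>T Q\<close>, which can have a nonzero
  entry at \<open>(i, j)\<close> only if the eigenvalues \<open>l' $ i\<close> and \<open>l $ j\<close> agree. Hence \<open>P\<close> intertwines any
  function of the eigenvalues, too.\<close>

lemma spectral_function_unique:
  fixes Q Q' :: "real^'n^'n"
  assumes Q: "orthogonal_matrix Q" and Q': "orthogonal_matrix Q'"
    and eq: "Q ** diag_mat l ** transpose Q = Q' ** diag_mat l' ** transpose Q'"
  shows "Q ** diag_mat (\<chi> i. g (l $ i)) ** transpose Q = Q' ** diag_mat (\<chi> i. g (l' $ i)) ** transpose Q'"
proof -
  define P where "P = transpose Q' ** Q"
  have conj: "Q ** D ** transpose Q = Q' ** D' ** transpose Q' \<longleftrightarrow> P ** D = D' ** P" for D D'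
    using Q Q' unfolding P_def orthogonal_matrix_def
    by (metis (no_types, lifting) matrix_mul_assoc matrix_mul_lid matrix_mul_rid)
  have "P $ i $ j * l $ j = l' $ i * P $ i $ j" for i j
    using eq unfolding conj by (metis matrix_mult_diag_mat diag_mat_matrix_mult)
  then have "P $ i $ j * g (l $ j) = g (l' $ i) * P $ i $ j" for i j
    by (cases "P $ i $ j = 0") (metis mult.commute mult_cancel_left mult_zero_left)+
  then show ?thesis
    unfolding conj by (simp add: vec_eq_iff matrix_mult_diag_mat diag_mat_matrix_mult)
qed

lemma threshold_spectral:
  assumes "orthogonal_matrix Q"
  shows "threshold \<nu> (Q ** diag_mat l ** transpose Q)
    = Q ** diag_mat (\<chi> i. max 0 (l $ i - \<nu>)) ** transpose Q"
  unfolding threshold_def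
  using assms spectral_function_unique[OF assms, where g = "\<lambda>x. max 0 (x - \<nu>)"]
  by (intro the_equality) (blast, elim exE conjE, simp)

lemma inner_orthogonal_conjugate:
  fixes Q :: "real^'n^'n"
  assumes "orthogonal_matrix Q"
  shows "(Q ** D ** transpose Q) \<bullet> (Q ** E ** transpose Q) = D \<bullet> E"
proof -
  have "transpose (Q ** D ** transpose Q) ** (Q ** E ** transpose Q)
      = Q ** (transpose D ** E ** transpose Q)"
    using assms unfolding orthogonal_matrix_def matrix_transpose_mul transpose_transpose
    by (metis matrix_mul_assoc matrix_mul_lid)
  also have "trace \<dots> = trace (transpose D ** E ** (transpose Q ** Q))"
    by (subst trace_mul_sym) (simp add: matrix_mul_assoc)
  finally show ?thesis
    using assms by (simp add: inner_matrix_trace orthogonal_matrix_def)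
qed

lemma trace_orthogonal_conjugate:
  fixes Q :: "real^'n^'n"
  assumes "orthogonal_matrix Q"
  shows "trace (Q ** D ** transpose Q) = trace D"
  using assms unfolding orthogonal_matrix_def
  by (metis matrix_mul_assoc matrix_mul_lid trace_mul_sym)

lemma inner_diag_mat: "diag_mat u \<bullet> diag_mat v = u \<bullet> v"
  by (simp add: inner_vec_def diag_mat_def if_distrib if_distribR sum.delta cong: if_cong)

lemma trace_diag_mat: "trace (diag_mat u) = sum (($) u) UNIV"
  by (simp add: trace_def diag_mat_def)

lemma threshold_sym_mats:
  fixes Y :: "real^'n^'n"
  assumes "Y \<in> sym_mats"
  shows "threshold \<nu> Y \<in> sym_mats"
proof -
  obtain Q l where Q: "orthogonal_matrix Q" "Y = Q ** diag_mat l ** transpose Q"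
    using symmetric_matrix_spectral[OF assms] .
  have "transpose (diag_mat v) = diag_mat v" for v :: "real^'n"
    by (auto simp: transpose_def diag_mat_def vec_eq_iff)
  with Q show ?thesis
    by (simp add: threshold_spectral sym_mats_def matrix_transpose_mul matrix_mul_assoc)
qed

text \<open>Each thresholded eigenvalue \<open>g = max 0 (\<alpha> - \<nu>)\<close> satisfies \<open>g\<^sup>2 = g \<alpha> - \<nu> g\<close>. Geometrically, the
  threshold is the projection of \<open>Y - \<nu> I\<close> to the cone of positive semidefinite matrices.\<close>

lemma norm_threshold_power2:
  fixes Y :: "real^'n^'n"
  assumes "Y \<in> sym_mats"
  shows "(norm (threshold \<nu> Y))\<^sup>2 = threshold \<nu> Y \<bullet> Y - \<nu> * trace (threshold \<nu> Y)"
proof -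
  obtain Q l where Q: "orthogonal_matrix Q" "Y = Q ** diag_mat l ** transpose Q"
    using symmetric_matrix_spectral[OF assms] .
  define g :: "real^'n" where "g = (\<chi> i. max 0 (l $ i - \<nu>))"
  have "g $ i * g $ i = g $ i * l $ i - \<nu> * g $ i" for i
    by (simp add: g_def max_def algebra_simps)
  then have "g \<bullet> g = g \<bullet> l - \<nu> * sum (($) g) UNIV"
    by (simp add: inner_vec_def sum_subtractf sum_distrib_left)
  then show ?thesis
    unfolding Q(2) threshold_spectral[OF Q(1)] power2_norm_eq_inner inner_orthogonal_conjugate[OF Q(1)]
      trace_orthogonal_conjugate[OF Q(1)] inner_diag_mat trace_diag_mat g_def .
qed

text \<open>For nonnegative eigenvalues, the Euclidean norm is at most the sum.\<close>

lemma norm_threshold_le_trace: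
  fixes Y :: "real^'n^'n"
  assumes "Y \<in> sym_mats"
  shows "norm (threshold \<nu> Y) \<le> trace (threshold \<nu> Y)"
proof -
  obtain Q l where Q: "orthogonal_matrix Q" "Y = Q ** diag_mat l ** transpose Q"
    using symmetric_matrix_spectral[OF assms] .
  define g :: "real^'n" where "g = (\<chi> i. max 0 (l $ i - \<nu>))"
  have "norm g \<le> (\<Sum>i\<in>UNIV. \<bar>g $ i\<bar>)"
    by (rule norm_le_l1_cart)
  also have "\<dots> = sum (($) g) UNIV"
    by (simp add: g_def)
  finally show ?thesis
    unfolding Q(2) threshold_spectral[OF Q(1)] norm_eq_sqrt_inner inner_orthogonal_conjugate[OF Q(1)]
      trace_orthogonal_conjugate[OF Q(1)] inner_diag_mat trace_diag_mat g_def .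
qed

text \<open>This is what makes the iteration reach zero: the threshold \<open>\<tau> \<mu>\<close> takes away more than a
  perturbation \<open>\<tau> G\<close> with \<open>\<parallel>G\<parallel> < \<mu>\<close> can add. The maximum accounts for the case that the result is
  already zero.\<close>

lemma norm_threshold_step_le:
  assumes "Z - \<tau> *\<^sub>R G \<in> sym_mats" "\<tau> \<ge> 0" "\<mu> \<ge> 0"
  shows "norm (threshold (\<tau> * \<mu>) (Z - \<tau> *\<^sub>R G)) \<le> max 0 (norm Z - \<tau> * (\<mu> - norm G))"
proof -
  define T where "T = threshold (\<tau> * \<mu>) (Z - \<tau> *\<^sub>R G)"
  have "(norm T)\<^sup>2 = T \<bullet> Z - \<tau> * (T \<bullet> G) - \<tau> * \<mu> * trace T"
    using norm_threshold_power2[OF assms(1)] by (simp add: T_def inner_diff_right)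
  moreover have "T \<bullet> Z \<le> norm T * norm Z"
    by (rule norm_cauchy_schwarz)
  moreover have "\<tau> * (- (T \<bullet> G)) \<le> \<tau> * (norm T * norm G)"
    using assms(2) norm_cauchy_schwarz[of T "- G"] by (intro mult_left_mono) auto
  moreover have "\<tau> * \<mu> * norm T \<le> \<tau> * \<mu> * trace T"
    using assms norm_threshold_le_trace unfolding T_def by (intro mult_left_mono) auto
  ultimately have "norm T * norm T \<le> norm T * (norm Z - \<tau> * (\<mu> - norm G))"
    by (simp add: power2_eq_square algebra_simps)
  then show ?thesis
    unfolding T_def[symmetric] by (cases "norm T = 0") (auto simp: mult_le_cancel_left)
qed


section \<open>The Gram operator and its adjoint\<close>

lemma sym_mats_diff: "U \<in> sym_mats \<Longrightarrow> V \<in> sym_mats \<Longrightarrow> U - V \<in> sym_mats"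
  by (simp add: sym_mats_def transpose_def vec_eq_iff)

lemma sym_mats_scaleR: "U \<in> sym_mats \<Longrightarrow> c *\<^sub>R U \<in> sym_mats"
  by (simp add: sym_mats_def transpose_def vec_eq_iff)

lemma sym_adjoint_gram_map_sym_mats: "sym_adjoint (gram_map m mon) y \<in> sym_mats"
  by (simp add: sym_adjoint_gram_map sym_mats_def transpose_def gram_mat_def vec_eq_iff add.commute)

lemma linear_sym_adjoint_gram_map: "linear (sym_adjoint (gram_map m mon))"
  unfolding sym_adjoint_gram_map
  by (intro linearI) (simp_all add: scaleR_add_left sum.distrib scaleR_sum_right)

lemma linear_gram_map: "linear (gram_map m mon)"
  unfolding gram_map_def inner_matrix_trace[symmetric]
  by (intro linearI) (simp_all add: vec_eq_iff inner_right_distrib)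

lemma gram_map_inner: "gram_map m mon X \<bullet> y = X \<bullet> sym_adjoint (gram_map m mon) y"
  unfolding sym_adjoint_gram_map inner_sum_right inner_scaleR_right
  unfolding inner_vec_def[of "gram_map m mon X"]
  by (simp add: gram_map_def inner_matrix_trace[symmetric] inner_commute mult.commute)

text \<open>Every product \<open>m $ j + m $ k\<close> is at most one of the monomials \<open>mon i\<close>, so the entry at
  \<open>(j, k)\<close> is a single coordinate of \<open>y\<close> or zero.\<close>

lemma norm_sym_adjoint_gram_map_le:
  fixes m :: "('s monom)^'n" and mon :: "'p::finite \<Rightarrow> 's monom"
  assumes "inj mon"
  shows "norm (sym_adjoint (gram_map m mon) y) \<le> real CARD('n) * norm y"
proof -
  define G where "G = sym_adjoint (gram_map m mon) y"
  have entry: "\<bar>G $ j $ k\<bar> \<le> norm y" for j k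
  proof -
    have G: "G $ j $ k = (\<Sum>i\<in>UNIV. if m $ j + m $ k = mon i then y $ i else 0)"
      by (auto simp: G_def sym_adjoint_gram_map gram_mat_def intro!: sum.cong)
    show ?thesis
    proof (cases "\<exists>i. m $ j + m $ k = mon i")
      case True
      then obtain i where "m $ j + m $ k = mon i" ..
      then have "G $ j $ k = y $ i"
        using assms by (simp add: G inj_eq)
      then show ?thesis
        by (simp add: component_le_norm_cart)
    qed (simp add: G)
  qed
  have "G \<bullet> G = (\<Sum>j\<in>UNIV. \<Sum>k\<in>UNIV. (G $ j $ k)\<^sup>2)"
    by (simp add: inner_vec_def power2_eq_square)
  also have "\<dots> \<le> (\<Sum>j\<in>(UNIV :: 'n set). \<Sum>k\<in>(UNIV :: 'n set). (norm y)\<^sup>2)"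
    using entry by (intro sum_mono) (simp add: abs_le_square_iff[symmetric])
  also have "\<dots> = (real CARD('n) * norm y)\<^sup>2"
    by (simp add: power2_eq_square)
  finally have "(norm G)\<^sup>2 \<le> (real CARD('n) * norm y)\<^sup>2"
    by (simp only: power2_norm_eq_inner)
  then show ?thesis
    unfolding G_def by (rule power2_le_imp_le) simp
qed

lemma norm_gram_map_le_sym_onorm:
  assumes "X \<in> sym_mats"
  shows "norm (gram_map m mon X) \<le> sym_onorm (gram_map m mon) * norm X"
proof (cases "X = 0")
  case False
  obtain K where K: "\<And>X. norm (gram_map m mon X) \<le> K * norm X"
    using linear_bounded[OF linear_gram_map] by blast
  have "K \<ge> 0"
    using False order_trans[OF norm_ge_zero K[of X]] by (simp add: zero_le_mult_iff)
  then have "bdd_above ((\<lambda>X. norm (gram_map m mon X) / norm X) ` sym_mats)"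
    using K by (intro bdd_aboveI2[where M = K]) (auto simp: divide_le_eq)
  then have "norm (gram_map m mon X) / norm X \<le> sym_onorm (gram_map m mon)"
    unfolding sym_onorm_def using assms by (rule cSUP_upper2) simp
  with False show ?thesis
    by (simp add: divide_le_eq)
qed (simp add: linear_0[OF linear_gram_map])

text \<open>The operator norm also bounds the adjoint, because \<open>\<parallel>A\<^sup>* y\<parallel>\<^sup>2 = \<langle>A (A\<^sup>* y), y\<rangle>\<close>.\<close>

lemma norm_sym_adjoint_gram_map_le_sym_onorm:
  fixes m :: "('s monom)^'n" and mon :: "'p::finite \<Rightarrow> 's monom"
  shows "norm (sym_adjoint (gram_map m mon) y) \<le> sym_onorm (gram_map m mon) * norm y"
proof -
  define G where "G = sym_adjoint (gram_map m mon) y"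
  have "norm G * norm G = gram_map m mon G \<bullet> y"
    by (simp add: gram_map_inner G_def dot_square_norm power2_eq_square)
  also have "\<dots> \<le> norm (gram_map m mon G) * norm y"
    by (rule norm_cauchy_schwarz)
  also have "\<dots> \<le> (sym_onorm (gram_map m mon) * norm G) * norm y"
    unfolding G_def
    by (intro mult_right_mono norm_gram_map_le_sym_onorm sym_adjoint_gram_map_sym_mats) simp
  finally have *: "norm G * norm G \<le> norm G * (sym_onorm (gram_map m mon) * norm y)"
    by (simp add: algebra_simps)
  have nonneg: "0 \<le> sym_onorm (gram_map m mon) * norm y"
  proof -
    \<comment> \<open>a nonzero symmetric matrix shows that the supremum of the quotients is nonnegative\<close>
    have one: "(mat 1 :: real^'n^'n) \<in> sym_mats"
      by (simp add: sym_mats_def transpose_mat)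
    have "(mat 1 :: real^'n^'n) \<noteq> 0"
      by (simp add: mat_def vec_eq_iff)
    then have "0 \<le> sym_onorm (gram_map m mon)"
      using order_trans[OF norm_ge_zero norm_gram_map_le_sym_onorm[OF one, of m mon]]
      by (simp add: zero_le_mult_iff)
    then show ?thesis
      by simp
  qed
  show ?thesis
    unfolding G_def[symmetric] using * nonneg by (cases "norm G = 0") (auto simp: mult_le_cancel_left)
qed

text \<open>Expanding the square gives \<open>\<parallel>X\<parallel>\<^sup>2 - 2 \<tau> \<parallel>A X\<parallel>\<^sup>2 + \<tau>\<^sup>2 \<parallel>A\<^sup>* (A X)\<parallel>\<^sup>2\<close>, and the last term is at most
  \<open>\<tau> L\<^sup>2 \<cdot> \<tau> \<parallel>A X\<parallel>\<^sup>2\<close>, which the middle term compensates when \<open>\<tau> L\<^sup>2 \<le> 2\<close>.\<close>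

lemma norm_gradient_step_le:
  fixes A :: "'a::real_inner \<Rightarrow> 'b::real_inner" and A' :: "'b \<Rightarrow> 'a"
  assumes adj: "A X \<bullet> A X = X \<bullet> A' (A X)" and bound: "norm (A' (A X)) \<le> L * norm (A X)"
    and \<tau>: "0 \<le> \<tau>" "\<tau> * L\<^sup>2 \<le> 2"
  shows "norm (X - \<tau> *\<^sub>R A' (A X)) \<le> norm X"
proof -
  define a where "a = (norm (A X))\<^sup>2"
  have "(norm (A' (A X)))\<^sup>2 \<le> L\<^sup>2 * a"
    using power_mono[OF bound norm_ge_zero, of 2] by (simp add: power_mult_distrib a_def)
  then have "\<tau>\<^sup>2 * (norm (A' (A X)))\<^sup>2 \<le> \<tau>\<^sup>2 * (L\<^sup>2 * a)"
    by (intro mult_left_mono) simp_all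
  also have "\<dots> = (\<tau> * L\<^sup>2) * (\<tau> * a)"
    by (simp add: power2_eq_square algebra_simps)
  also have "\<dots> \<le> 2 * (\<tau> * a)"
    using \<tau> by (intro mult_right_mono) (simp_all add: a_def)
  finally have "\<tau>\<^sup>2 * (norm (A' (A X)))\<^sup>2 \<le> 2 * (\<tau> * a)" .
  moreover have "(norm (X - \<tau> *\<^sub>R A' (A X)))\<^sup>2 = (norm X)\<^sup>2 - 2 * (\<tau> * a) + \<tau>\<^sup>2 * (norm (A' (A X)))\<^sup>2"
    using adj unfolding a_def power2_norm_eq_inner
    by (simp add: inner_diff_left inner_diff_right inner_commute[of "A' (A X)" X]
        power2_eq_square algebra_simps)
  ultimately have "(norm (X - \<tau> *\<^sub>R A' (A X)))\<^sup>2 \<le> (norm X)\<^sup>2"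
    by simp
  then show ?thesis
    by (rule power2_le_imp_le) simp
qed


section \<open>Finite convergence to zero\<close>

lemma eventually_zero_if_norm_decreases:
  fixes X :: "nat \<Rightarrow> 'a::real_normed_vector"
  assumes "c > 0" and step: "\<And>k. norm (X (Suc k)) \<le> max 0 (norm (X k) - c)"
  shows "eventually (\<lambda>k. X k = 0) sequentially"
proof -
  have bound: "norm (X k) \<le> max 0 (norm (X 0) - real k * c)" for k
  proof (induction k)
    case (Suc k)
    then show ?case
      using step[of k] assms(1) by (auto simp: algebra_simps max_def split: if_splits)
  qed simp
  obtain N where N: "norm (X 0) < real N * c"
    using reals_Archimedean3[OF assms(1)] by blast
  have "X k = 0" if "k \<ge> N" for k
  proof -
    have "real N * c \<le> real k * c"
      using that assms(1) by simp
    then show ?thesis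
      using bound[of k] N by simp
  qed
  then show ?thesis
    by (auto simp: eventually_sequentially)
qed

theorem theorem4:
  fixes f :: "'s::finite rpoly" and d :: nat
    and m :: "('s monom)^'n" and mon :: "'p::finite \<Rightarrow> 's monom"
    and A :: "real^'n^'n \<Rightarrow> real^'p" and b :: "real^'p"
    and \<mu> \<tau> :: real and h :: "real^'n^'n \<Rightarrow> real^'n^'n"
    and Wstar :: "real^'n^'n" and X Y :: "nat \<Rightarrow> real^'n^'n"
  assumes "total_degree f = 2 * d"
    and "\<And>j. monom_degree (m $ j) \<le> d"
    and "gram_monomials f m mon"
    and "A = gram_map m mon"
    and "b = gram_rhs mon f"
    and "\<mu> > 0"
    and "0 < \<tau>" and "\<tau> < 2 / (sym_onorm A)\<^sup>2"
    and "\<And>Z. Z \<in> sym_mats \<Longrightarrow> h Z = Z - \<tau> *\<^sub>R sym_adjoint A (A Z - b)"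
    and "Wstar \<in> psd_mats"
    and "norm (A Wstar - b) < \<mu> / real CARD('n)"
    and "Wstar = threshold (\<tau> * \<mu>) (h Wstar)"
    and "X 0 \<in> sym_mats"
    and "\<And>k. Y k = X k - \<tau> *\<^sub>R sym_adjoint A (A (X k) - b)"
    and "\<And>k. X (Suc k) = threshold (\<tau> * \<mu>) (Y k)"
  shows "X \<longlonglongrightarrow> Wstar"
proof -
  define A' where "A' = sym_adjoint A"
  note A = \<open>A = gram_map m mon\<close>
  have inj: "inj mon"
    using \<open>gram_monomials f m mon\<close> by (simp add: gram_monomials_def)
  have A'_sym: "A' y \<in> sym_mats" for y
    by (simp add: A'_def A sym_adjoint_gram_map_sym_mats)
  have A'_lin: "linear A'"
    by (simp add: A'_def A linear_sym_adjoint_gram_map)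
  have A'_small: "norm (A' y) < \<mu>" if "norm y < \<mu> / real CARD('n)" for y
  proof -
    have "norm (A' y) \<le> real CARD('n) * norm y"
      by (simp add: A'_def A norm_sym_adjoint_gram_map_le[OF inj])
    also have "\<dots> < \<mu>"
      using that by (simp add: field_simps)
    finally show ?thesis .
  qed
  have W_sym: "Wstar \<in> sym_mats"
    using \<open>Wstar \<in> psd_mats\<close> by (simp add: psd_mats_def)

  have W0: "Wstar = 0"
  proof -
    define G where "G = A' (A Wstar - b)"
    have "norm G < \<mu>"
      unfolding G_def by (rule A'_small) fact
    have hW: "h Wstar = Wstar - \<tau> *\<^sub>R G"
      using assms(9)[OF W_sym] by (simp add: G_def A'_def)
    have "Wstar - \<tau> *\<^sub>R G \<in> sym_mats"
      by (simp add: G_def W_sym A'_sym sym_mats_diff sym_mats_scaleR)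
    then have "norm (threshold (\<tau> * \<mu>) (Wstar - \<tau> *\<^sub>R G)) \<le> max 0 (norm Wstar - \<tau> * (\<mu> - norm G))"
      using \<open>0 < \<tau>\<close> \<open>\<mu> > 0\<close> by (intro norm_threshold_step_le) simp_all
    then have "norm Wstar \<le> max 0 (norm Wstar - \<tau> * (\<mu> - norm G))"
      using assms(12) by (simp add: hW[symmetric])
    moreover have "\<tau> * (\<mu> - norm G) > 0"
      using \<open>norm G < \<mu>\<close> \<open>0 < \<tau>\<close> by simp
    ultimately show ?thesis
      by (auto simp: max_def split: if_splits)
  qed

  have "A Wstar = 0"
    by (simp add: W0 A linear_0[OF linear_gram_map])
  then have b_small: "norm (A' b) < \<mu>"
    using assms(11) by (intro A'_small) simp

  have step_size: "\<tau> * (sym_onorm A)\<^sup>2 \<le> 2"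
    using assms(7,8) by (cases "sym_onorm A = 0") (simp_all add: field_simps)
  have Y: "Y k = (X k - \<tau> *\<^sub>R A' (A (X k))) - \<tau> *\<^sub>R (- A' b)" for k
    by (simp add: assms(14) A'_def[symmetric] linear_diff[OF A'_lin] algebra_simps)
  have Y_sym: "Y k \<in> sym_mats" if "X k \<in> sym_mats" for k
    unfolding assms(14) A'_def[symmetric] by (intro sym_mats_diff sym_mats_scaleR that A'_sym)
  have X_sym: "X k \<in> sym_mats" for k
    by (induction k) (simp_all add: assms(13,15) threshold_sym_mats Y_sym)

  have "norm (X (Suc k)) \<le> max 0 (norm (X k) - \<tau> * (\<mu> - norm (A' b)))" for k
  proof -
    have "norm (X (Suc k)) \<le> max 0 (norm (X k - \<tau> *\<^sub>R A' (A (X k))) - \<tau> * (\<mu> - norm (- A' b)))"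
      unfolding assms(15) Y using Y_sym[OF X_sym, of k] \<open>0 < \<tau>\<close> \<open>\<mu> > 0\<close>
      by (intro norm_threshold_step_le) (simp_all add: Y)
    moreover have "norm (X k - \<tau> *\<^sub>R A' (A (X k))) \<le> norm (X k)"
      using \<open>0 < \<tau>\<close> step_size
      by (intro norm_gradient_step_le[where L = "sym_onorm A"])
        (simp_all add: A'_def A gram_map_inner norm_sym_adjoint_gram_map_le_sym_onorm)
    ultimately show ?thesis
      by simp
  qed
  then have "eventually (\<lambda>k. X k = 0) sequentially"
    using \<open>0 < \<tau>\<close> b_small 
    by (intro eventually_zero_if_norm_decreases[where c = "\<tau> * (\<mu> - norm (A' b))"]) auto
  then show ?thesis
    unfolding W0 by (rule tendsto_eventually)
qed

end
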